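(* In the distributed detection system with $N$ sensors under data falsification attacks described in the context, the threshold $$T^*=\frac{\log\left(\frac{\pi_0}{\pi_1}\right)+N\log\left(\frac{1-\widetilde{\pi}_{1,0}}{1-\widetilde{\pi}_{1,1}}\right)}{\log\left(\frac{\widetilde{\pi}_{1,1}(1-\widetilde{\pi}_{1,0})}{\widetilde{\pi}_{1,0}(1-\widetilde{\pi}_{1,1})}\right)}$$ is optimal for the fusion center: among all real thresholds $T$, the choice $T=T^*$ minimizes the probability of error both of the unordered system and of the system using the energy-efficient ordered transmission (EEOT) scheme.
   Context: Model. Hypotheses $\mathcal{H}_0,\mathcal{H}_1$ have prior probabilities $\pi_0,\pi_1>0$, $\pi_0+\pi_1=1$. There are $N\ge 1$ sensors. Conditionally on the hypothesis, the observations $y_1,\dots,y_N$ are i.i.d., with $y_i\sim\mathcal{N}(0,\sigma^2)$ under $\mathcal{H}_0$ and $y_i\sim\mathcal{N}(s,\sigma^2)$ under $\mathcal{H}_1$, where $s>0$ and $\sigma>0$. Sensor $i$ computes the log-likelihood ratio $L_i=\log\big(f(y_i|\mathcal{H}_1)/f(y_i|\mathcal{H}_0)\big)$ and the local decision $v_i=1$ if $L_i>\lambda$, $v_i=0$ otherwise, with $\lambda=\log(\pi_0/\pi_1)$. Attack. Each sensor is independently malicious with probability $\alpha<1/2$. A malicious sensor flips its decision with probability $p\in[0,1]$; honest sensors do not flip. Thus, independently over sensors and independently of the observations, the decision $u_i$ sent to the fusion center (FC) is $u_i=1-v_i$ with probability $\alpha p$ and $u_i=v_i$ with probability $1-\alpha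 p$. Write $\widetilde{\pi}_{1,h}=\Pr(u_i=1|\mathcal{H}_h)$ for $h=0,1$. Unordered system with threshold $T$. The FC receives all $u_i$ and decides $\mathcal{H}_1$ if $Z=\sum_{i=1}^N u_i\ge T$ and $\mathcal{H}_0$ if $Z<T$. EEOT system with threshold $T$. Sensors transmit in decreasing order of $|L_i|$: with $|L_{[1]}|>|L_{[2]}|>\dots>|L_{[N]}|$ (almost surely there are no ties), the FC receives $u_{[1]},u_{[2]},\dots$ in this order. At the first $k\in\{1,\dots,N\}$ for which one of the following holds, the FC stops and decides: it decides $\mathcal{H}_1$ if $\sum_{i=1}^k u_{[i]}\ge T$, and $\mathcal{H}_0$ if $\sum_{i=1}^k u_{[i]}<T-(N-k)$. The probability of error is $\pi_0\Pr(\text{decide }\mathcal{H}_1|\mathcal{H}_0)+\pi_1\Pr(\text{decide }\mathcal{H}_0|\mathcal{H}_1)$. *)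

theory Defs
  imports "HOL-Probability.Probability"
begin

datatype hypothesis = H0 | H1

fun hyp_mean :: "real \<Rightarrow> hypothesis \<Rightarrow> real" where
  "hyp_mean s H0 = 0"
| "hyp_mean s H1 = s"

definition log_likelihood_ratio :: "real \<Rightarrow> real \<Rightarrow> real \<Rightarrow> real" where
  "log_likelihood_ratio s \<sigma> x =
     ln (normal_density (hyp_mean s H1) \<sigma> x / normal_density (hyp_mean s H0) \<sigma> x)"

definition local_decision :: "(hypothesis \<Rightarrow> real) \<Rightarrow> real \<Rightarrow> real \<Rightarrow> real \<Rightarrow> nat" where
  "local_decision \<pi> s \<sigma> x =
     (if log_likelihood_ratio s \<sigma> x > ln (\<pi> H0 / \<pi> H1) then 1 else 0)"

text \<open>
  \<open>P h\<close> is the conditional law given hypothesis \<open>h\<close>. Honest sensors never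
  flip, so \<open>flip i\<close> is contained in \<open>mal i\<close>. The equation for \<open>mal i \<and> flip i\<close> says that the
  conditional flipping probability of a malicious sensor is \<open>p\<close>, in a form that also makes sense
  for \<open>\<alpha> = 0\<close>. The last two conditions together give the joint independence of
  all observations and all pairs \<open>(mal i, flip i)\<close>; \<open>indep_set\<close> is used because \<open>indep_var\<close> needs both
  variables to have the same type.
\<close>

definition sensor_model ::
  "nat \<Rightarrow> real \<Rightarrow> real \<Rightarrow> real \<Rightarrow> real \<Rightarrow> (hypothesis \<Rightarrow> 'a measure) \<Rightarrow> (nat \<Rightarrow> 'a \<Rightarrow> real) \<Rightarrow>
   (nat \<Rightarrow> 'a \<Rightarrow> bool) \<Rightarrow> (nat \<Rightarrow> 'a \<Rightarrow> bool) \<Rightarrow> bool" where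
  "sensor_model N s \<sigma> \<alpha> p P y mal flip \<longleftrightarrow>
     (\<forall>h. prob_space (P h) \<and>
       (\<forall>i\<in>{1..N}.
          distributed (P h) lborel (y i) (\<lambda>x. ennreal (normal_density (hyp_mean s h) \<sigma> x)) \<and>
          mal i \<in> measurable (P h) (count_space UNIV) \<and>
          flip i \<in> measurable (P h) (count_space UNIV) \<and>
          measure (P h) {\<omega> \<in> space (P h). mal i \<omega>} = \<alpha> \<and>
          measure (P h) {\<omega> \<in> space (P h). mal i \<omega> \<and> flip i \<omega>} = \<alpha> * p \<and>
          (\<forall>\<omega>\<in>space (P h). \<not> mal i \<omega> \<longrightarrow> \<not> flip i \<omega>) \<and>
          prob_space.indep_set (P h)
            {y i -` A \<inter> space (P h) |A. A \<in> sets borel}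
            {(\<lambda>\<omega>. (mal i \<omega>, flip i \<omega>)) -` B \<inter> space (P h) |B. B \<in> sets (count_space UNIV)}) \<and>
       prob_space.indep_vars (P h) (\<lambda>i. borel \<Otimes>\<^sub>M count_space UNIV)
         (\<lambda>i \<omega>. (y i \<omega>, (mal i \<omega>, flip i \<omega>))) {1..N})"

definition sensor_llr :: "real \<Rightarrow> real \<Rightarrow> (nat \<Rightarrow> 'a \<Rightarrow> real) \<Rightarrow> 'a \<Rightarrow> nat \<Rightarrow> real" where
  "sensor_llr s \<sigma> y \<omega> i = log_likelihood_ratio s \<sigma> (y i \<omega>)"

definition sent_bit ::
  "(hypothesis \<Rightarrow> real) \<Rightarrow> real \<Rightarrow> real \<Rightarrow> (nat \<Rightarrow> 'a \<Rightarrow> real) \<Rightarrow> (nat \<Rightarrow> 'a \<Rightarrow> bool) \<Rightarrow>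
   'a \<Rightarrow> nat \<Rightarrow> nat" where
  "sent_bit \<pi> s \<sigma> y flip \<omega> i =
     (let v = local_decision \<pi> s \<sigma> (y i \<omega>) in if flip i \<omega> then 1 - v else v)"

definition unordered_decides :: "nat \<Rightarrow> real \<Rightarrow> (nat \<Rightarrow> nat) \<Rightarrow> hypothesis \<Rightarrow> bool" where
  "unordered_decides N T u d \<longleftrightarrow>
     (case d of H1 \<Rightarrow> real (\<Sum>i=1..N. u i) \<ge> T | H0 \<Rightarrow> real (\<Sum>i=1..N. u i) < T)"

text \<open>The sort is stable: ties, which have probability zero, are broken by the sensor index.\<close>

definition transmission_order :: "nat \<Rightarrow> (nat \<Rightarrow> real) \<Rightarrow> nat list" where
  "transmission_order N L = sort_key (\<lambda>i. - \<bar>L i\<bar>) [1..<Suc N]"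

definition received_sum :: "nat \<Rightarrow> (nat \<Rightarrow> real) \<Rightarrow> (nat \<Rightarrow> nat) \<Rightarrow> nat \<Rightarrow> nat" where
  "received_sum N L u k = (\<Sum>i\<leftarrow>take k (transmission_order N L). u i)"

definition eeot_condition ::
  "nat \<Rightarrow> real \<Rightarrow> (nat \<Rightarrow> real) \<Rightarrow> (nat \<Rightarrow> nat) \<Rightarrow> hypothesis \<Rightarrow> nat \<Rightarrow> bool" where
  "eeot_condition N T L u d k \<longleftrightarrow>
     (case d of H1 \<Rightarrow> real (received_sum N L u k) \<ge> T
              | H0 \<Rightarrow> real (received_sum N L u k) < T - (real N - real k))"

definition eeot_decides ::
  "nat \<Rightarrow> real \<Rightarrow> (nat \<Rightarrow> real) \<Rightarrow> (nat \<Rightarrow> nat) \<Rightarrow> hypothesis \<Rightarrow> bool" where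
  "eeot_decides N T L u d \<longleftrightarrow>
     (\<exists>k\<in>{1..N}. eeot_condition N T L u d k \<and>
        (\<forall>j\<in>{1..<k}. \<forall>d'. \<not> eeot_condition N T L u d' j))"

definition error_prob ::
  "(hypothesis \<Rightarrow> real) \<Rightarrow> (hypothesis \<Rightarrow> 'a measure) \<Rightarrow> ('a \<Rightarrow> hypothesis \<Rightarrow> bool) \<Rightarrow> real" where
  "error_prob \<pi> P decides =
     \<pi> H0 * measure (P H0) {\<omega> \<in> space (P H0). decides \<omega> H1} +
     \<pi> H1 * measure (P H1) {\<omega> \<in> space (P H1). decides \<omega> H0}"

definition unordered_error ::
  "nat \<Rightarrow> (hypothesis \<Rightarrow> real) \<Rightarrow> real \<Rightarrow> real \<Rightarrow> (hypothesis \<Rightarrow> 'a measure) \<Rightarrow>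
   (nat \<Rightarrow> 'a \<Rightarrow> real) \<Rightarrow> (nat \<Rightarrow> 'a \<Rightarrow> bool) \<Rightarrow> real \<Rightarrow> real" where
  "unordered_error N \<pi> s \<sigma> P y flip T =
     error_prob \<pi> P (\<lambda>\<omega>. unordered_decides N T (sent_bit \<pi> s \<sigma> y flip \<omega>))"

definition eeot_error ::
  "nat \<Rightarrow> (hypothesis \<Rightarrow> real) \<Rightarrow> real \<Rightarrow> real \<Rightarrow> (hypothesis \<Rightarrow> 'a measure) \<Rightarrow>
   (nat \<Rightarrow> 'a \<Rightarrow> real) \<Rightarrow> (nat \<Rightarrow> 'a \<Rightarrow> bool) \<Rightarrow> real \<Rightarrow> real" where
  "eeot_error N \<pi> s \<sigma> P y flip T =
     error_prob \<pi> P
       (\<lambda>\<omega>. eeot_decides N T (sensor_llr s \<sigma> y \<omega>) (sent_bit \<pi> s \<sigma> y flip \<omega>))"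

definition sent_one_prob ::
  "(hypothesis \<Rightarrow> real) \<Rightarrow> real \<Rightarrow> real \<Rightarrow> (hypothesis \<Rightarrow> 'a measure) \<Rightarrow>
   (nat \<Rightarrow> 'a \<Rightarrow> real) \<Rightarrow> (nat \<Rightarrow> 'a \<Rightarrow> bool) \<Rightarrow> nat \<Rightarrow> hypothesis \<Rightarrow> real" where
  "sent_one_prob \<pi> s \<sigma> P y flip i h =
     measure (P h) {\<omega> \<in> space (P h). sent_bit \<pi> s \<sigma> y flip \<omega> i = 1}"

definition optimal_threshold ::
  "nat \<Rightarrow> (hypothesis \<Rightarrow> real) \<Rightarrow> (hypothesis \<Rightarrow> real) \<Rightarrow> real" where
  "optimal_threshold N \<pi> q =
     (ln (\<pi> H0 / \<pi> H1) + real N * ln ((1 - q H0) / (1 - q H1))) /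
     ln (q H1 * (1 - q H0) / (q H0 * (1 - q H1)))"

end

theory Submission
  imports Defs
begin

text \<open>
  When the EEOT fusion center stops, the bits still missing can no longer change whether
  \<open>Z \<ge> T\<close>, so its decision agrees with the unordered one on every realization of the bits, for
  every ordering of the sensors. For the unordered system, the set \<open>S\<close> of sensors that sent
  \<open>1\<close> has conditional probability \<open>w\<^sub>h(|S|) = q\<^sub>h^|S| (1 - q\<^sub>h)^(N - |S|)\<close>, and the error is the
  sum over \<open>S\<close> of \<open>\<pi>\<^sub>0 w\<^sub>0(|S|)\<close> or \<open>\<pi>\<^sub>1 w\<^sub>1(|S|)\<close> according as \<open>|S| \<ge> T\<close> or not.
  Taking logarithms, \<open>T\<^sup>*\<close> selects the smaller of the two in each term, provided
  \<open>0 < q\<^sub>0 < q\<^sub>1 < 1\<close>. This holds because shifting a Gaussian to the right strictly increases its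
  upper tail, and flipping with probability \<open>\<alpha> p < 1/2\<close> preserves the order.
\<close>

section \<open>Ordered against unordered decisions, for fixed bits\<close>

lemma sum_list_le_length:
  fixes f :: "'a \<Rightarrow> nat"
  assumes "\<And>x. f x \<le> 1"
  shows "(\<Sum>x\<leftarrow>xs. f x) \<le> length xs"
proof (induction xs)
  case (Cons x xs)
  then show ?case using assms[of x] by simp
qed simp

text \<open>The transmission order is a permutation of \<open>{1..N}\<close>, so the total is the
  received prefix plus \<open>N - k\<close> missing bits, each worth at most 1.\<close>

lemma received_sum_bounds:
  assumes "\<And>i. u i \<le> 1" "k \<le> N"
  shows "received_sum N L u k \<le> (\<Sum>i=1..N. u i)"
    and "(\<Sum>i=1..N. u i) \<le> received_sum N L u k + (N - k)"
proof -
  define xs where "xs = transmission_order N L"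
  have "set xs = {1..N}" "distinct xs" "length xs = N"
    by (auto simp: xs_def transmission_order_def)
  then have "(\<Sum>i=1..N. u i) = (\<Sum>i\<leftarrow>xs. u i)"
    by (metis sum_list_distinct_conv_sum_set)
  also have "\<dots> = received_sum N L u k + (\<Sum>i\<leftarrow>drop k xs. u i)"
    unfolding received_sum_def xs_def[symmetric]
    by (metis append_take_drop_id map_append sum_list_append)
  finally show "received_sum N L u k \<le> (\<Sum>i=1..N. u i)"
    and "(\<Sum>i=1..N. u i) \<le> received_sum N L u k + (N - k)"
    using sum_list_le_length[of u "drop k xs"] assms(1) \<open>length xs = N\<close> by auto
qed

lemma eeot_decides_iff_unordered_decides:
  assumes "N \<ge> 1" and u: "\<And>i. u i \<le> 1"
  shows "eeot_decides N T L u d \<longleftrightarrow> unordered_decides N T u d"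
proof -
  \<comment> \<open>This holds at every \<open>k\<close> satisfying a condition, not just at the
    first. The worst cases for the missing bits are all 0 for \<open>H1\<close> and all 1 for
    \<open>H0\<close>.\<close>
  have sound: "unordered_decides N T u d" if "eeot_condition N T L u d k" "k \<in> {1..N}" for d k
  proof -
    have "k \<le> N" using that by simp
    note received_sum_bounds[of u k N L, OF u this]
    then have "real (received_sum N L u k) \<le> real (\<Sum>i=1..N. u i)"
      "real (\<Sum>i=1..N. u i) \<le> real (received_sum N L u k) + (real N - real k)"
      using \<open>k \<le> N\<close> by linarith+
    then show ?thesis
      using that unfolding eeot_condition_def unordered_decides_def
      by (auto split: hypothesis.splits simp del: of_nat_sum)
  qed
  have total: "received_sum N L u N = (\<Sum>i=1..N. u i)"
    using received_sum_bounds[of u N N L, OF u order_refl] by simp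
  \<comment> \<open>At \<open>k = N\<close> no bit is missing, the slack \<open>N - k\<close>
    vanishes, and the conditions become the unordered rule. So the procedure always stops.\<close>
  have final: "eeot_condition N T L u d N" if "unordered_decides N T u d" for d
    using that unfolding eeot_condition_def unordered_decides_def total
    by (cases d) simp_all
  have unique: "d = d'" if "unordered_decides N T u d" "unordered_decides N T u d'" for d d'
    using that unfolding unordered_decides_def by (cases d; cases d') simp_all
  show ?thesis
  proof
    assume "eeot_decides N T L u d"
    then show "unordered_decides N T u d"
      unfolding eeot_decides_def using sound by blast
  next
    assume d: "unordered_decides N T u d"
    define Q where "Q k \<longleftrightarrow> k \<in> {1..N} \<and> (\<exists>d'. eeot_condition N T L u d' k)" for k
    define k where "k = (LEAST k. Q k)"
    have "Q N" using final[OF d] \<open>N \<ge> 1\<close> by (auto simp: Q_def)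
    then have "Q k" unfolding k_def by (rule LeastI)
    then obtain d' where k: "k \<in> {1..N}" "eeot_condition N T L u d' k" by (auto simp: Q_def)
    have "\<not> Q j" if "j < k" for j using not_less_Least that unfolding k_def by blast
    then have "\<forall>j\<in>{1..<k}. \<forall>d'. \<not> eeot_condition N T L u d' j"
      using k(1) by (auto simp: Q_def)
    \<comment> \<open>The first stop could a priori give another decision; but it agrees with the
      unordered one, which is unique.\<close>
    moreover have "d' = d" using sound[OF k(2,1)] d by (rule unique)
    ultimately show "eeot_decides N T L u d"
      unfolding eeot_decides_def using k by blast
  qed
qed

section \<open>Thresholds as likelihood comparisons\<close>

lemma optimal_threshold_le_iff:
  assumes pi: "\<pi> H0 > 0" "\<pi> H1 > 0"
    and q: "0 < q H0" "q H0 < q H1" "q H1 < 1"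
    and k: "k \<le> N"
  shows "optimal_threshold N \<pi> q \<le> real k \<longleftrightarrow>
    \<pi> H0 * (q H0 ^ k * (1 - q H0) ^ (N - k)) \<le> \<pi> H1 * (q H1 ^ k * (1 - q H1) ^ (N - k))"
proof -
  have pos: "0 < q H1" "0 < 1 - q H0" "0 < 1 - q H1" using q by auto
  \<comment> \<open>The odds \<open>q / (1 - q)\<close> increase with \<open>q\<close>, so the
    denominator of the optimal threshold is positive and dividing by it preserves the
    inequality.\<close>
  have "q H0 * (1 - q H1) < q H1 * (1 - q H0)" using q by (simp add: algebra_simps)
  then have D: "ln (q H1 * (1 - q H0) / (q H0 * (1 - q H1))) > 0"
    using pos q by (intro ln_gt_zero) simp
  have "\<pi> H0 * (q H0 ^ k * (1 - q H0) ^ (N - k)) \<le> \<pi> H1 * (q H1 ^ k * (1 - q H1) ^ (N - k)) \<longleftrightarrow>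
    ln (\<pi> H0 * (q H0 ^ k * (1 - q H0) ^ (N - k))) \<le> ln (\<pi> H1 * (q H1 ^ k * (1 - q H1) ^ (N - k)))"
    using pi q pos by (intro ln_le_cancel_iff[symmetric]) simp_all
  \<comment> \<open>Both logarithms are affine in \<open>k\<close>, which is why the comparison
    reduces to a threshold on \<open>k\<close>.\<close>
  also have "\<dots> \<longleftrightarrow> ln (\<pi> H0) + (real k * ln (q H0) + (real N - real k) * ln (1 - q H0))
      \<le> ln (\<pi> H1) + (real k * ln (q H1) + (real N - real k) * ln (1 - q H1))"
    using pi q pos k by (simp add: ln_mult ln_realpow of_nat_diff)
  also have "\<dots> \<longleftrightarrow> ln (\<pi> H0 / \<pi> H1) + real N * ln ((1 - q H0) / (1 - q H1))
      \<le> real k * ln (q H1 * (1 - q H0) / (q H0 * (1 - q H1)))"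
  proof -
    have "ln (\<pi> H0 / \<pi> H1) = ln (\<pi> H0) - ln (\<pi> H1)"
      "ln ((1 - q H0) / (1 - q H1)) = ln (1 - q H0) - ln (1 - q H1)"
      "ln (q H1 * (1 - q H0) / (q H0 * (1 - q H1))) =
        ln (q H1) + ln (1 - q H0) - ln (q H0) - ln (1 - q H1)"
      using pi q pos by (simp_all add: ln_mult ln_div)
    then show ?thesis by (simp only:) (simp add: algebra_simps)
  qed
  also have "\<dots> \<longleftrightarrow> optimal_threshold N \<pi> q \<le> real k"
    unfolding optimal_threshold_def using D by (simp add: pos_divide_le_eq)
  finally show ?thesis by simp
qed

text \<open>Equal variances cancel the quadratic terms: the log-likelihood ratio is affine in
  \<open>x\<close> with slope \<open>s / \<sigma>\<^sup>2 > 0\<close>.\<close>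

lemma local_decision_threshold:
  assumes "s > 0" "\<sigma> > 0"
  shows "local_decision \<pi> s \<sigma> x =
    (if x > s / 2 + \<sigma>\<^sup>2 * ln (\<pi> H0 / \<pi> H1) / s then 1 else 0)"
proof -
  have "log_likelihood_ratio s \<sigma> x = - (x - s)\<^sup>2 / (2 * \<sigma>\<^sup>2) - (- x\<^sup>2 / (2 * \<sigma>\<^sup>2))"
    using assms unfolding log_likelihood_ratio_def normal_density_def
    by (simp add: exp_diff[symmetric])
  also have "\<dots> = (x - s / 2) * s / \<sigma>\<^sup>2"
    using assms by (simp add: field_simps power2_eq_square)
  finally have "ln (\<pi> H0 / \<pi> H1) < log_likelihood_ratio s \<sigma> x \<longleftrightarrow>
      \<sigma>\<^sup>2 * ln (\<pi> H0 / \<pi> H1) < (x - s / 2) * s"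
    using assms by (simp add: pos_less_divide_eq mult.commute)
  also have "\<dots> \<longleftrightarrow> s / 2 + \<sigma>\<^sup>2 * ln (\<pi> H0 / \<pi> H1) / s < x"
    using assms by (simp add: less_diff_eq add.commute flip: pos_divide_less_eq)
  finally show ?thesis by (simp add: local_decision_def)
qed

section \<open>Gaussian tails and independent indicators on one probability space\<close>

context prob_space
begin

text \<open>The density is positive everywhere, so an interval of probability zero would be Lebesgue
  null.\<close>

lemma normal_interval_prob_pos:
  assumes X: "distributed M lborel X (\<lambda>x. ennreal (normal_density \<mu> \<sigma> x))"
    and "\<sigma> > 0" "a < b"
  shows "prob {\<omega> \<in> space M. a < X \<omega> \<and> X \<omega> \<le> b} > 0"
proof -
  have "emeasure M (X -` {a<..b} \<inter> space M) =
      (\<integral>\<^sup>+x. ennreal (normal_density \<mu> \<sigma> x) * indicator {a<..b} x \<partial>lborel)"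
    using X by (rule distributed_emeasure) simp
  moreover have "\<dots> \<noteq> 0"
  proof
    assume "(\<integral>\<^sup>+x. ennreal (normal_density \<mu> \<sigma> x) * indicator {a<..b} x \<partial>lborel) = 0"
    then have "AE x in lborel. ennreal (normal_density \<mu> \<sigma> x) * indicator {a<..b} x = 0"
      by (subst (asm) nn_integral_0_iff_AE) auto
    then have "AE x in lborel. x \<notin> {a<..b}"
      using less_imp_neq[OF normal_density_pos[OF \<open>\<sigma> > 0\<close>]]
      by (elim eventually_mono) (auto simp: indicator_def order.antisym split: if_splits)
    then have "emeasure lborel {a<..b} = 0"
      by (subst (asm) AE_iff_measurable[where N = "{a<..b}"]) auto
    then show False using \<open>a < b\<close> by simp
  qed
  moreover have "X -` {a<..b} \<inter> space M = {\<omega> \<in> space M. a < X \<omega> \<and> X \<omega> \<le> b}" by auto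
  ultimately have "emeasure M {\<omega> \<in> space M. a < X \<omega> \<and> X \<omega> \<le> b} \<noteq> 0" by simp
  then show ?thesis by (simp add: emeasure_eq_measure ennreal_eq_0_iff not_le)
qed

text \<open>A unit interval on either side of \<open>c\<close> already carries positive
  mass.\<close>

lemma normal_tail_bounds:
  assumes X: "distributed M lborel X (\<lambda>x. ennreal (normal_density \<mu> \<sigma> x))" and "\<sigma> > 0"
  shows "0 < prob {\<omega> \<in> space M. c < X \<omega>}" "prob {\<omega> \<in> space M. c < X \<omega>} < 1"
proof -
  have [measurable]: "X \<in> borel_measurable M" using distributed_measurable[OF X] by simp
  have "0 < prob {\<omega> \<in> space M. c < X \<omega> \<and> X \<omega> \<le> c + 1}"
    using normal_interval_prob_pos[OF assms] by simp
  also have "\<dots> \<le> prob {\<omega> \<in> space M. c < X \<omega>}" by (intro finite_measure_mono) auto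
  finally show "0 < prob {\<omega> \<in> space M. c < X \<omega>}" .
  have "0 < prob {\<omega> \<in> space M. c - 1 < X \<omega> \<and> X \<omega> \<le> c}"
    using normal_interval_prob_pos[OF assms] by simp
  also have "\<dots> \<le> prob {\<omega> \<in> space M. \<not> c < X \<omega>}" by (intro finite_measure_mono) auto
  also have "\<dots> = 1 - prob {\<omega> \<in> space M. c < X \<omega>}" by (rule prob_neg) simp
  finally show "prob {\<omega> \<in> space M. c < X \<omega>} < 1" by simp
qed

text \<open>The shift adds exactly the mass of the interval from \<open>c - s\<close> to
  \<open>c\<close>.\<close>

lemma normal_tail_shift_less:
  assumes X: "distributed M lborel X (\<lambda>x. ennreal (normal_density \<mu> \<sigma> x))"
    and "\<sigma> > 0" "s > 0"
  shows "prob {\<omega> \<in> space M. c < X \<omega>} < prob {\<omega> \<in> space M. c < X \<omega> + s}"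
proof -
  have [measurable]: "X \<in> borel_measurable M" using distributed_measurable[OF X] by simp
  have "prob {\<omega> \<in> space M. c < X \<omega> + s} =
      prob ({\<omega> \<in> space M. c < X \<omega>} \<union> {\<omega> \<in> space M. c - s < X \<omega> \<and> X \<omega> \<le> c})"
    using \<open>s > 0\<close> by (intro arg_cong[where f = prob]) auto
  also have "\<dots> = prob {\<omega> \<in> space M. c < X \<omega>} + prob {\<omega> \<in> space M. c - s < X \<omega> \<and> X \<omega> \<le> c}"
    by (intro finite_measure_Union) auto
  finally show ?thesis
    using normal_interval_prob_pos[OF X \<open>\<sigma> > 0\<close>, of "c - s" c] \<open>s > 0\<close> by simp
qed

lemma prob_random_set_eq:
  assumes U: "indep_vars (\<lambda>_. count_space UNIV) U I"
    and fin: "finite I" "I \<noteq> {}"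
    and q: "\<And>i. i \<in> I \<Longrightarrow> prob {\<omega> \<in> space M. U i \<omega>} = q"
    and S: "S \<subseteq> I"
  shows "prob {\<omega> \<in> space M. {i\<in>I. U i \<omega>} = S} = q ^ card S * (1 - q) ^ (card I - card S)"
proof -
  have [measurable]: "U i \<in> M \<rightarrow>\<^sub>M count_space UNIV" if "i \<in> I" for i
    using U that by (auto simp: indep_vars_def2)
  have factor: "prob (U i -` {i \<in> S} \<inter> space M) = (if i \<in> S then q else 1 - q)" if "i \<in> I" for i
  proof -
    have "prob {\<omega> \<in> space M. \<not> U i \<omega>} = 1 - prob {\<omega> \<in> space M. U i \<omega>}"
      using that by (intro prob_neg) simp
    moreover have "U i -` {i \<in> S} \<inter> space M = {\<omega> \<in> space M. U i \<omega> = (i \<in> S)}" by auto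
    ultimately show ?thesis using q[OF that] by (cases "i \<in> S") simp_all
  qed
  \<comment> \<open>Prescribing the random set prescribes every indicator. As \<open>I\<close> is
    nonempty, the intersection stays inside \<open>space M\<close>.\<close>
  have "{\<omega> \<in> space M. {i\<in>I. U i \<omega>} = S} = (\<Inter>i\<in>I. U i -` {i \<in> S} \<inter> space M)"
    using S fin by auto
  also have "prob \<dots> = (\<Prod>i\<in>I. prob (U i -` {i \<in> S} \<inter> space M))"
    using fin by (intro indep_varsD[OF U]) auto
  also have "\<dots> = (\<Prod>i\<in>I. if i \<in> S then q else 1 - q)"
    using factor by (intro prod.cong) auto
  also have "\<dots> = q ^ card S * (1 - q) ^ card (I - S)"
    using fin S by (simp add: prod.If_cases Int_absorb1 Diff_eq)
  finally show ?thesis using fin S by (simp add: card_Diff_subset finite_subset)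
qed

text \<open>Summing over sets instead of cardinalities avoids binomial coefficients and suits the
  later term-by-term comparison.\<close>

lemma prob_card_random_set:
  assumes U: "indep_vars (\<lambda>_. count_space UNIV) U I"
    and fin: "finite I" "I \<noteq> {}"
    and q: "\<And>i. i \<in> I \<Longrightarrow> prob {\<omega> \<in> space M. U i \<omega>} = q"
  shows "prob {\<omega> \<in> space M. Q (card {i\<in>I. U i \<omega>})} =
    (\<Sum>S\<in>Pow I. if Q (card S) then q ^ card S * (1 - q) ^ (card I - card S) else 0)"
proof -
  have [measurable]: "U i \<in> M \<rightarrow>\<^sub>M count_space UNIV" if "i \<in> I" for i
    using U that by (auto simp: indep_vars_def2)
  define E where "E S = {\<omega> \<in> space M. {i\<in>I. U i \<omega>} = S}" for S
  have "E S \<in> events" if "S \<subseteq> I" for S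
  proof -
    have "E S = {\<omega> \<in> space M. \<forall>i\<in>I. U i \<omega> = (i \<in> S)}" using that by (auto simp: E_def)
    also have "\<dots> \<in> events" using fin by (intro sets.sets_Collect_finite_All) measurable
    finally show ?thesis .
  qed
  then have "prob (\<Union>S\<in>{S\<in>Pow I. Q (card S)}. E S) = (\<Sum>S | S \<in> Pow I \<and> Q (card S). prob (E S))"
    using fin by (intro finite_measure_finite_Union) (auto simp: E_def disjoint_family_on_def)
  also have "(\<Union>S\<in>{S\<in>Pow I. Q (card S)}. E S) = {\<omega> \<in> space M. Q (card {i\<in>I. U i \<omega>})}"
    by (auto simp: E_def)
  also have "(\<Sum>S | S \<in> Pow I \<and> Q (card S). prob (E S)) =
      (\<Sum>S | S \<in> Pow I \<and> Q (card S). q ^ card S * (1 - q) ^ (card I - card S))"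
    unfolding E_def using prob_random_set_eq[OF U fin q] by (intro sum.cong) auto
  also have "\<dots> = (\<Sum>S\<in>Pow I. if Q (card S) then q ^ card S * (1 - q) ^ (card I - card S) else 0)"
    using fin by (intro sum.inter_filter) simp
  finally show ?thesis .
qed

text \<open>Meant for \<open>A\<close> = local decision 1 and \<open>B\<close> = flip: the sent bit
  is 1 exactly when one of the two occurs without the other.\<close>

lemma prob_sym_diff_indep:
  assumes "A \<in> events" "B \<in> events" "prob (A \<inter> B) = prob A * prob B"
  shows "prob ((A - B) \<union> (B - A)) = prob A * (1 - prob B) + prob B * (1 - prob A)"
proof -
  have "prob ((A - B) \<union> (B - A)) = prob (A - B) + prob (B - A)"
    using assms(1,2) by (intro finite_measure_Union) auto
  also have "prob (A - B) = prob A - prob (A \<inter> B)"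
    using assms(1,2) by (rule finite_measure_Diff')
  also have "prob (B - A) = prob B - prob (A \<inter> B)"
    unfolding Int_commute[of A B] using assms(2,1) by (rule finite_measure_Diff')
  finally show ?thesis unfolding assms(3) by (simp add: algebra_simps)
qed

end

section \<open>Law of a single sent bit\<close>

text \<open>Defined on the real line rather than on a sample space, so that tails under the separate
  measures \<open>P H0\<close> and \<open>P H1\<close> can be compared.\<close>

definition normal_tail :: "real \<Rightarrow> real \<Rightarrow> real \<Rightarrow> real" where
  "normal_tail \<mu> \<sigma> c = measure (density lborel (\<lambda>x. ennreal (normal_density \<mu> \<sigma> x))) {c<..}"

lemma distributed_normal_tail:
  assumes X: "distributed M lborel X (\<lambda>x. ennreal (normal_density \<mu> \<sigma> x))"
  shows "measure M {\<omega> \<in> space M. c < X \<omega>} = normal_tail \<mu> \<sigma> c"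
proof -
  have "X \<in> measurable M lborel" using X by (rule distributed_measurable)
  then have "measure (distr M lborel X) {c<..} = measure M (X -` {c<..} \<inter> space M)"
    by (rule measure_distr) simp
  moreover have "X -` {c<..} \<inter> space M = {\<omega> \<in> space M. c < X \<omega>}" by auto
  ultimately show ?thesis
    using distributed_distr_eq_density[OF X] by (simp add: normal_tail_def)
qed

text \<open>The common value of \<open>sent_one_prob\<close> at all sensors, when a bit is flipped with probability
  \<open>r\<close> and the local decision compares the observation with \<open>c\<close>.\<close>

definition sent_one_value :: "real \<Rightarrow> real \<Rightarrow> real \<Rightarrow> real \<Rightarrow> hypothesis \<Rightarrow> real" where
  "sent_one_value s \<sigma> r c h =
     normal_tail (hyp_mean s h) \<sigma> c * (1 - r) + r * (1 - normal_tail (hyp_mean s h) \<sigma> c)"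

text \<open>The observation at which the log-likelihood ratio equals \<open>ln (\<pi> H0 / \<pi> H1)\<close>.\<close>

definition llr_cutoff :: "(hypothesis \<Rightarrow> real) \<Rightarrow> real \<Rightarrow> real \<Rightarrow> real" where
  "llr_cutoff \<pi> s \<sigma> = s / 2 + \<sigma>\<^sup>2 * ln (\<pi> H0 / \<pi> H1) / s"

lemma sent_bit_eq_1_iff:
  assumes "s > 0" "\<sigma> > 0"
  shows "sent_bit \<pi> s \<sigma> y flip \<omega> i = 1 \<longleftrightarrow> (llr_cutoff \<pi> s \<sigma> < y i \<omega>) \<noteq> flip i \<omega>"
  by (simp add: sent_bit_def Let_def local_decision_threshold[OF assms] llr_cutoff_def)

lemma sent_bit_le_1: "sent_bit \<pi> s \<sigma> y flip \<omega> i \<le> 1"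
  by (simp add: sent_bit_def Let_def local_decision_def)

text \<open>Flipping acts on the tail \<open>t\<close> as the affine map
  \<open>r + (1 - 2 * r) * t\<close>, strictly increasing for \<open>r < 1 / 2\<close> and mapping
  the open unit interval into itself.\<close>

lemma sent_one_value_bounds:
  assumes X: "prob_space M" "distributed M lborel X (\<lambda>x. ennreal (normal_density 0 \<sigma> x))"
    and "s > 0" "\<sigma> > 0" "0 \<le> r" "r < 1 / 2"
  shows "0 < sent_one_value s \<sigma> r c H0"
    and "sent_one_value s \<sigma> r c H0 < sent_one_value s \<sigma> r c H1"
    and "sent_one_value s \<sigma> r c H1 < 1"
proof -
  interpret prob_space M by fact
  \<comment> \<open>A variable with the \<open>H1\<close> law is built on the \<open>H0\<close>
    space by translation, so both tails are events of one measure.\<close>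
  have X': "distributed M lborel (\<lambda>\<omega>. X \<omega> + s) (\<lambda>x. ennreal (normal_density s \<sigma> x))"
    using normal_density_affine[OF X(2) \<open>\<sigma> > 0\<close>, of 1 s] by (simp add: add.commute)
  let ?a = "normal_tail 0 \<sigma> c" and ?b = "normal_tail s \<sigma> c"
  have a: "0 < ?a" "?a < 1"
    using normal_tail_bounds[OF X(2) \<open>\<sigma> > 0\<close>] distributed_normal_tail[OF X(2)] by simp_all
  have b: "0 < ?b" "?b < 1"
    using normal_tail_bounds[OF X' \<open>\<sigma> > 0\<close>] distributed_normal_tail[OF X'] by simp_all
  have "?a < ?b"
    using normal_tail_shift_less[OF X(2) \<open>\<sigma> > 0\<close> \<open>s > 0\<close>, of c]
      distributed_normal_tail[OF X(2), of c] distributed_normal_tail[OF X', of c] by simp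
  then have "?a * (1 - 2 * r) < ?b * (1 - 2 * r)" using \<open>r < 1 / 2\<close> by simp
  then show "sent_one_value s \<sigma> r c H0 < sent_one_value s \<sigma> r c H1"
    by (simp add: sent_one_value_def algebra_simps)
  show "0 < sent_one_value s \<sigma> r c H0"
    using a assms by (simp add: sent_one_value_def add_pos_nonneg)
  have "0 < (1 - ?b) * (1 - r) + r * ?b"
    using b assms by (intro add_pos_nonneg mult_pos_pos mult_nonneg_nonneg) auto
  then show "sent_one_value s \<sigma> r c H1 < 1"
    by (simp add: sent_one_value_def algebra_simps)
qed

lemma sent_one_prob_eq:
  assumes model: "sensor_model N s \<sigma> \<alpha> p P y mal flip"
    and "s > 0" "\<sigma> > 0" "i \<in> {1..N}"
  shows "sent_one_prob \<pi> s \<sigma> P y flip i h = sent_one_value s \<sigma> (\<alpha> * p) (llr_cutoff \<pi> s \<sigma>) h"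
proof -
  let ?c = "llr_cutoff \<pi> s \<sigma>"
  interpret prob_space "P h" using model by (simp add: sensor_model_def)
  have Y: "distributed (P h) lborel (y i) (\<lambda>x. ennreal (normal_density (hyp_mean s h) \<sigma> x))"
    and F: "flip i \<in> measurable (P h) (count_space UNIV)"
    and mp: "prob {\<omega> \<in> space (P h). mal i \<omega> \<and> flip i \<omega>} = \<alpha> * p"
    and honest: "\<And>\<omega>. \<omega> \<in> space (P h) \<Longrightarrow> \<not> mal i \<omega> \<Longrightarrow> \<not> flip i \<omega>"
    and ind: "indep_set {y i -` A \<inter> space (P h) |A. A \<in> sets borel}
      {(\<lambda>\<omega>. (mal i \<omega>, flip i \<omega>)) -` B \<inter> space (P h) |B. B \<in> sets (count_space UNIV)}"
    using model \<open>i \<in> {1..N}\<close> unfolding sensor_model_def by blast+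
  note [measurable] = F
  have [measurable]: "y i \<in> borel_measurable (P h)" using distributed_measurable[OF Y] by simp
  let ?A = "{\<omega> \<in> space (P h). ?c < y i \<omega>}" and ?B = "{\<omega> \<in> space (P h). flip i \<omega>}"
  \<comment> \<open>Only malicious sensors flip, so the flip probability is
    \<open>\<alpha> * p\<close>.\<close>
  have "?B = {\<omega> \<in> space (P h). mal i \<omega> \<and> flip i \<omega>}" using honest by auto
  then have B: "prob ?B = \<alpha> * p" using mp by simp
  have "?A \<in> {y i -` A \<inter> space (P h) |A. A \<in> sets borel}"
    unfolding mem_Collect_eq by (rule exI[of _ "{?c<..}"]) auto
  moreover have "?B \<in> {(\<lambda>\<omega>. (mal i \<omega>, flip i \<omega>)) -` B \<inter> space (P h) |B. B \<in> sets (count_space UNIV)}"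
    unfolding mem_Collect_eq by (rule exI[of _ "UNIV \<times> {True}"]) auto
  ultimately have "prob (?A \<inter> ?B) = prob ?A * prob ?B" by (rule indep_setD[OF ind])
  moreover have "?A \<in> events" "?B \<in> events" by measurable
  ultimately have "prob ((?A - ?B) \<union> (?B - ?A)) = prob ?A * (1 - prob ?B) + prob ?B * (1 - prob ?A)"
    by (rule prob_sym_diff_indep[rotated 2])
  moreover have "{\<omega> \<in> space (P h). sent_bit \<pi> s \<sigma> y flip \<omega> i = 1} = (?A - ?B) \<union> (?B - ?A)"
    unfolding sent_bit_eq_1_iff[OF \<open>s > 0\<close> \<open>\<sigma> > 0\<close>] by blast
  ultimately show ?thesis
    unfolding sent_one_prob_def sent_one_value_def B distributed_normal_tail[OF Y] by (simp only:)
qed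

text \<open>Each bit is one fixed measurable function \<open>g\<close> of the sensor's observation
  and attack pair, so independence is inherited.\<close>

lemma indep_vars_sent_bits:
  assumes model: "sensor_model N s \<sigma> \<alpha> p P y mal flip"
    and "s > 0" "\<sigma> > 0"
  shows "prob_space.indep_vars (P h) (\<lambda>_. count_space UNIV)
    (\<lambda>i \<omega>. sent_bit \<pi> s \<sigma> y flip \<omega> i = 1) {1..N}"
proof -
  interpret prob_space "P h" using model by (simp add: sensor_model_def)
  define g :: "real \<times> bool \<times> bool \<Rightarrow> bool" where
    "g = (\<lambda>z. (llr_cutoff \<pi> s \<sigma> < fst z) \<noteq> snd (snd z))"
  have "indep_vars (\<lambda>i. borel \<Otimes>\<^sub>M count_space UNIV) (\<lambda>i \<omega>. (y i \<omega>, (mal i \<omega>, flip i \<omega>))) {1..N}"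
    using model unfolding sensor_model_def by blast
  moreover have "g \<in> borel \<Otimes>\<^sub>M count_space UNIV \<rightarrow>\<^sub>M count_space UNIV"
  proof -
    have [measurable]: "(\<lambda>z::real \<times> bool \<times> bool. snd (snd z))
        \<in> borel \<Otimes>\<^sub>M count_space UNIV \<rightarrow>\<^sub>M count_space UNIV"
      by (rule measurable_compose[OF measurable_snd]) simp
    show ?thesis unfolding g_def by measurable
  qed
  ultimately have "indep_vars (\<lambda>_. count_space UNIV)
      (\<lambda>i \<omega>. g (y i \<omega>, (mal i \<omega>, flip i \<omega>))) {1..N}"
    by (rule indep_vars_compose2)
  then show ?thesis
    by (simp only: g_def fst_conv snd_conv sent_bit_eq_1_iff[OF \<open>s > 0\<close> \<open>\<sigma> > 0\<close>])
qed

section \<open>Error probabilities and their minimization\<close>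

lemma sum_sent_bits:
  "(\<Sum>i=1..N. sent_bit \<pi> s \<sigma> y flip \<omega> i) = card {i\<in>{1..N}. sent_bit \<pi> s \<sigma> y flip \<omega> i = 1}"
proof -
  have "(\<Sum>i=1..N. sent_bit \<pi> s \<sigma> y flip \<omega> i) =
      (\<Sum>i=1..N. if sent_bit \<pi> s \<sigma> y flip \<omega> i = 1 then 1 else 0)"
    using sent_bit_le_1[of \<pi> s \<sigma> y flip \<omega>] by (intro sum.cong) (auto simp: le_Suc_eq)
  then show ?thesis by (simp add: sum.If_cases Int_def)
qed

text \<open>The two decisions are complementary, so each \<open>S\<close> enters exactly one error
  term. The threshold only selects which of two costs is charged to \<open>S\<close>.\<close>

lemma unordered_error_eq_sum:
  fixes N :: nat and q :: "hypothesis \<Rightarrow> real"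
  defines "w \<equiv> \<lambda>h k. q h ^ k * (1 - q h) ^ (N - k)"
  assumes model: "sensor_model N s \<sigma> \<alpha> p P y mal flip"
    and "s > 0" "\<sigma> > 0" "N \<ge> 1"
    and q: "\<And>i h. i \<in> {1..N} \<Longrightarrow> sent_one_prob \<pi> s \<sigma> P y flip i h = q h"
  shows "unordered_error N \<pi> s \<sigma> P y flip T =
    (\<Sum>S\<in>Pow {1..N}. if T \<le> real (card S) then \<pi> H0 * w H0 (card S) else \<pi> H1 * w H1 (card S))"
proof -
  have law: "measure (P h) {\<omega> \<in> space (P h). Q (\<Sum>i=1..N. sent_bit \<pi> s \<sigma> y flip \<omega> i)} =
      (\<Sum>S\<in>Pow {1..N}. if Q (card S) then w h (card S) else 0)" for h Q
  proof -
    interpret prob_space "P h" using model by (simp add: sensor_model_def)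
    show ?thesis
      unfolding sum_sent_bits w_def
      using prob_card_random_set[OF indep_vars_sent_bits[OF model \<open>s > 0\<close> \<open>\<sigma> > 0\<close>, of h \<pi>],
          of "q h" Q] q[of _ h] \<open>N \<ge> 1\<close>
      by (simp add: sent_one_prob_def cong: if_cong)
  qed
  have "unordered_error N \<pi> s \<sigma> P y flip T =
      \<pi> H0 * (\<Sum>S\<in>Pow {1..N}. if T \<le> real (card S) then w H0 (card S) else 0) +
      \<pi> H1 * (\<Sum>S\<in>Pow {1..N}. if real (card S) < T then w H1 (card S) else 0)"
    unfolding unordered_error_def error_prob_def unordered_decides_def hypothesis.case
    by (simp only: law[of _ "\<lambda>k. T \<le> real k"] law[of _ "\<lambda>k. real k < T"])
  also have "\<dots> = (\<Sum>S\<in>Pow {1..N}. if T \<le> real (card S) then \<pi> H0 * w H0 (card S)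
      else \<pi> H1 * w H1 (card S))"
    unfolding sum_distrib_left sum.distrib[symmetric] by (intro sum.cong) auto
  finally show ?thesis .
qed

text \<open>The decisions agree at every sample point, ties included, so the error events
  coincide.\<close>

lemma eeot_error_eq_unordered_error:
  assumes "N \<ge> 1"
  shows "eeot_error N \<pi> s \<sigma> P y flip T = unordered_error N \<pi> s \<sigma> P y flip T"
proof -
  have "eeot_decides N T (sensor_llr s \<sigma> y \<omega>) (sent_bit \<pi> s \<sigma> y flip \<omega>) =
      unordered_decides N T (sent_bit \<pi> s \<sigma> y flip \<omega>)" for \<omega>
    by (intro ext eeot_decides_iff_unordered_decides assms sent_bit_le_1)
  then show ?thesis by (simp only: eeot_error_def unordered_error_def)
qed

theorem mainTheorem3:
  fixes N :: nat
    and \<pi> :: "hypothesis \<Rightarrow> real"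
    and s \<sigma> \<alpha> p :: real
    and P :: "hypothesis \<Rightarrow> 'a measure"
    and y :: "nat \<Rightarrow> 'a \<Rightarrow> real"
    and mal flip :: "nat \<Rightarrow> 'a \<Rightarrow> bool"
  assumes "\<pi> H0 > 0" "\<pi> H1 > 0" "\<pi> H0 + \<pi> H1 = 1"
    and "N \<ge> 1"
    and "s > 0" "\<sigma> > 0"
    and "0 \<le> \<alpha>" "\<alpha> < 1 / 2"
    and "0 \<le> p" "p \<le> 1"
    and "sensor_model N s \<sigma> \<alpha> p P y mal flip"
  shows "\<forall>i\<in>{1..N}.
    (let T_opt = optimal_threshold N \<pi> (sent_one_prob \<pi> s \<sigma> P y flip i) in
      (\<forall>T::real. unordered_error N \<pi> s \<sigma> P y flip T_opt \<le> unordered_error N \<pi> s \<sigma> P y flip T) \<and>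
      (\<forall>T::real. eeot_error N \<pi> s \<sigma> P y flip T_opt \<le> eeot_error N \<pi> s \<sigma> P y flip T))"
proof -
  define q where "q = sent_one_value s \<sigma> (\<alpha> * p) (llr_cutoff \<pi> s \<sigma>)"
  \<comment> \<open>All sensors share one \<open>q\<close>, so the threshold is the same for every
    \<open>i\<close>.\<close>
  have q_eq: "sent_one_prob \<pi> s \<sigma> P y flip i = q" if "i \<in> {1..N}" for i
    using sent_one_prob_eq[OF assms(11) \<open>s > 0\<close> \<open>\<sigma> > 0\<close> that] by (auto simp: q_def)
  have "\<alpha> * p \<le> \<alpha> * 1" using \<open>0 \<le> \<alpha>\<close> \<open>p \<le> 1\<close> by (rule mult_left_mono[rotated])
  then have r: "0 \<le> \<alpha> * p" "\<alpha> * p < 1 / 2" using \<open>0 \<le> \<alpha>\<close> \<open>0 \<le> p\<close> \<open>\<alpha> < 1 / 2\<close> by auto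
  \<comment> \<open>Sensor 1 under \<open>H0\<close>, present since \<open>N \<ge> 1\<close>,
    supplies the centred Gaussian variable from which the bounds on \<open>q\<close> follow.\<close>
  have "prob_space (P H0)"
    "distributed (P H0) lborel (y 1) (\<lambda>x. ennreal (normal_density 0 \<sigma> x))"
    using assms(11) \<open>N \<ge> 1\<close> unfolding sensor_model_def by (force dest: spec[of _ H0])+
  note q_bounds = sent_one_value_bounds[OF this \<open>s > 0\<close> \<open>\<sigma> > 0\<close> r,
      of "llr_cutoff \<pi> s \<sigma>", folded q_def]
  have error: "unordered_error N \<pi> s \<sigma> P y flip T = (\<Sum>S\<in>Pow {1..N}. if T \<le> real (card S)
      then \<pi> H0 * (q H0 ^ card S * (1 - q H0) ^ (N - card S))
      else \<pi> H1 * (q H1 ^ card S * (1 - q H1) ^ (N - card S)))" for T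
    by (rule unordered_error_eq_sum[OF assms(11) \<open>s > 0\<close> \<open>\<sigma> > 0\<close> \<open>N \<ge> 1\<close>]) (simp add: q_eq)
  have optimal: "unordered_error N \<pi> s \<sigma> P y flip (optimal_threshold N \<pi> q)
      \<le> unordered_error N \<pi> s \<sigma> P y flip T" for T
    unfolding error
  proof (rule sum_mono)
    fix S :: "nat set"
    assume "S \<in> Pow {1..N}"
    then have "card S \<le> N" using card_mono[of "{1..N}" S] by simp
    \<comment> \<open>The optimal threshold charges the smaller cost to \<open>S\<close>, while any
      \<open>T\<close> charges one of the same two.\<close>
    from optimal_threshold_le_iff[OF assms(1,2) q_bounds this]
    show "(if optimal_threshold N \<pi> q \<le> real (card S)
          then \<pi> H0 * (q H0 ^ card S * (1 - q H0) ^ (N - card S))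
          else \<pi> H1 * (q H1 ^ card S * (1 - q H1) ^ (N - card S)))
        \<le> (if T \<le> real (card S)
          then \<pi> H0 * (q H0 ^ card S * (1 - q H0) ^ (N - card S))
          else \<pi> H1 * (q H1 ^ card S * (1 - q H1) ^ (N - card S)))"
      by auto
  qed
  then show ?thesis
    by (simp add: q_eq eeot_error_eq_unordered_error[OF \<open>N \<ge> 1\<close>])
qed

end
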